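(* Let $\alpha,\beta,\gamma,\delta\in\mathbb{R}$ with $\alpha+\delta\neq0$ and $\alpha\gamma+\beta\delta=0$, and let $(G_5,g,J)$ be the connected three-dimensional non-unimodular Lie group with left-invariant Lorentzian metric $g$ whose Lie algebra has a pseudo-orthonormal basis $\{e_1,e_2,e_3\}$, $e_3$ timelike, with $$[e_1,e_2]=0,\quad [e_1,e_3]=\alpha e_1+\beta e_2,\quad [e_2,e_3]=\gamma e_1+\delta e_2,$$ and with the product structure $J$ given by $Je_1=e_1$, $Je_2=e_2$, $Je_3=-e_3$. Then (with no further condition on the parameters) $(G_5,g,J)$ admits left-invariant Ricci collineations associated to the Kobayashi-Nomizu connection $\nabla^1$.
   Context: Pseudo-orthonormal with $e_3$ timelike means $g(e_1,e_1)=g(e_2,e_2)=1$, $g(e_3,e_3)=-1$, $g(e_i,e_j)=0$ for $i\ne j$. $J$ is extended left-invariantly to a $(1,1)$-tensor with $J^2=\mathrm{id}$. Let $\nabla$ be the Levi-Civita connection of $g$. The canonical connection is $\nabla^0_XY=\nabla_XY-\frac12(\nabla_XJ)JY$, and the Kobayashi-Nomizu connection is $$\nabla^1_XY=\nabla^0_XY-\tfrac14\big[(\nabla_YJ)JX-(\nabla_{JY}J)X\big],$$ with curvature $R^1(X,Y)Z=\nabla^1_X\nabla^1_YZ-\nabla^1_Y\nabla^1_XZ-\nabla^1_{[X,Y]}Z$. Its Ricci tensor is $$\mathrm{Ric}^1(X,Y)=-g(R^1(X,e_1)Y,e_1)-g(R^1(X,e_2)Y,e_2)+g(R^1(X,e_3)Y,e_3),$$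 and its symmetrization is $\widetilde{\mathrm{Ric}}^1(X,Y)=\frac12\big(\mathrm{Ric}^1(X,Y)+\mathrm{Ric}^1(Y,X)\big)$. For a left-invariant vector field $\xi=\lambda_1e_1+\lambda_2e_2+\lambda_3e_3$ ($\lambda_i\in\mathbb{R}$), $$(L_\xi\widetilde{\mathrm{Ric}}^1)(X,Y)=\xi\big(\widetilde{\mathrm{Ric}}^1(X,Y)\big)-\widetilde{\mathrm{Ric}}^1([\xi,X],Y)-\widetilde{\mathrm{Ric}}^1(X,[\xi,Y]).$$ A left-invariant Ricci collineation associated to $\nabla^1$ is a left-invariant $\xi$ with $L_\xi\widetilde{\mathrm{Ric}}^1=0$. The group admits left-invariant Ricci collineations if there is a nonzero such $\xi$. *)

theory Defs
  imports "HOL-Analysis.Analysis" "HOL-Library.Function_Algebras"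
begin

text \<open>
  Sums, differences and zero of tangent vectors, vector fields and real-valued functions are the
  pointwise ones of \<^theory>\<open>HOL-Library.Function_Algebras\<close>.
\<close>

text \<open>Only meant for open \<open>S\<close>: derivatives are taken at \<open>x\<close>, not at \<open>x\<close> within \<open>S\<close>.\<close>

primrec Ck_on :: "nat \<Rightarrow> ('e::euclidean_space \<Rightarrow> 'f::euclidean_space) \<Rightarrow> 'e set \<Rightarrow> bool" where
  "Ck_on 0 f S \<longleftrightarrow> continuous_on S f"
| "Ck_on (Suc k) f S \<longleftrightarrow>
     (\<forall>x\<in>S. f differentiable (at x)) \<and> (\<forall>v. Ck_on k (\<lambda>x. frechet_derivative f (at x) v) S)"

definition smooth_on :: "('e::euclidean_space \<Rightarrow> 'f::euclidean_space) \<Rightarrow> 'e set \<Rightarrow> bool" where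
  "smooth_on f S \<longleftrightarrow> (\<forall>k. Ck_on k f S)"

text \<open>
  The manifold is the whole type \<open>'g\<close>; its dimension is that of the model space \<open>'e\<close>.  A chart is a
  pair of its domain and a map whose values outside the domain are irrelevant.
\<close>

type_synonym ('g, 'e) chart = "'g set \<times> ('g \<Rightarrow> 'e)"

definition smooth_atlas ::
  "('g::{t2_space, second_countable_topology}, 'e::euclidean_space) chart set \<Rightarrow> bool" where
  "smooth_atlas A \<longleftrightarrow>
     (\<Union>(U, \<phi>)\<in>A. U) = UNIV \<and>
     (\<forall>(U, \<phi>)\<in>A. open U \<and> open (\<phi> ` U) \<and> homeomorphism U (\<phi> ` U) \<phi> (inv_into U \<phi>)) \<and>
     (\<forall>(U, \<phi>)\<in>A. \<forall>(V, \<psi>)\<in>A. smooth_on (\<psi> \<circ> inv_into U \<phi>) (\<phi> ` (U \<inter> V)))"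

definition smooth_map ::
  "('g::topological_space, 'e::euclidean_space) chart set
   \<Rightarrow> ('h::topological_space, 'f::euclidean_space) chart set \<Rightarrow> ('g \<Rightarrow> 'h) \<Rightarrow> bool" where
  "smooth_map A B F \<longleftrightarrow> continuous_on UNIV F \<and>
     (\<forall>(U, \<phi>)\<in>A. \<forall>(V, \<psi>)\<in>B. smooth_on (\<psi> \<circ> F \<circ> inv_into U \<phi>) (\<phi> ` (U \<inter> F -` V)))"

definition smooth_fun ::
  "('g::topological_space, 'e::euclidean_space) chart set \<Rightarrow> ('g \<Rightarrow> real) \<Rightarrow> bool" where
  "smooth_fun A f \<longleftrightarrow> (\<forall>(U, \<phi>)\<in>A. smooth_on (f \<circ> inv_into U \<phi>) (\<phi> ` U))"

definition prod_atlas ::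
  "('g, 'e) chart set \<Rightarrow> ('h, 'f) chart set \<Rightarrow> ('g \<times> 'h, 'e \<times> 'f) chart set" where
  "prod_atlas A B = {(U \<times> V, map_prod \<phi> \<psi>) | U \<phi> V \<psi>. (U, \<phi>) \<in> A \<and> (V, \<psi>) \<in> B}"

text \<open>
  A tangent vector at \<open>p\<close> is the operator \<open>f \<mapsto> D(f \<circ> \<phi>\<^sup>-\<^sup>1)(\<phi> p) w\<close> on smooth functions, for a chart
  \<open>\<phi>\<close> around \<open>p\<close> and a vector \<open>w\<close> of the model space.  Its value is fixed to \<open>0\<close> on non-smooth
  functions, so that equality of tangent vectors is equality of HOL functions.
\<close>

type_synonym 'g tvec = "('g \<Rightarrow> real) \<Rightarrow> real"
type_synonym 'g vfield = "'g \<Rightarrow> 'g tvec"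

definition tangent_space ::
  "('g::topological_space, 'e::euclidean_space) chart set \<Rightarrow> 'g \<Rightarrow> 'g tvec set" where
  "tangent_space A p =
     {v. \<exists>(U, \<phi>)\<in>A. p \<in> U \<and>
        (\<exists>w. v = (\<lambda>f. if smooth_fun A f
                       then frechet_derivative (f \<circ> inv_into U \<phi>) (at (\<phi> p)) w else 0))}"

definition vector_field ::
  "('g::topological_space, 'e::euclidean_space) chart set \<Rightarrow> 'g vfield \<Rightarrow> bool" where
  "vector_field A X \<longleftrightarrow>
     (\<forall>p. X p \<in> tangent_space A p) \<and> (\<forall>f. smooth_fun A f \<longrightarrow> smooth_fun A (\<lambda>p. X p f))"

definition tscale :: "real \<Rightarrow> 'g tvec \<Rightarrow> 'g tvec" (infixr "*\<^sub>T" 75) where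
  "c *\<^sub>T v = (\<lambda>f. c * v f)"

definition cscale :: "real \<Rightarrow> 'g vfield \<Rightarrow> 'g vfield" (infixr "*\<^sub>V" 75) where
  "c *\<^sub>V X = (\<lambda>p. c *\<^sub>T X p)"

definition fscale :: "('g \<Rightarrow> real) \<Rightarrow> 'g vfield \<Rightarrow> 'g vfield" (infixr "*\<^sub>F" 75) where
  "h *\<^sub>F X = (\<lambda>p. h p *\<^sub>T X p)"

definition bracket :: "'g vfield \<Rightarrow> 'g vfield \<Rightarrow> 'g vfield" where
  "bracket X Y = (\<lambda>p f. X p (\<lambda>q. Y q f) - Y p (\<lambda>q. X q f))"

text \<open>
  The group is written additively; the class \<^class>\<open>group_add\<close> does not assume commutativity.
  Left translation by \<open>a\<close> is \<open>(+) a\<close>.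
\<close>

definition lie_group ::
  "('g::{group_add, t2_space, second_countable_topology}, 'e::euclidean_space) chart set \<Rightarrow> bool"
  where
  "lie_group A \<longleftrightarrow> smooth_atlas A \<and>
     smooth_map (prod_atlas A A) A (\<lambda>(a, b). a + b) \<and> smooth_map A A uminus"

definition left_push ::
  "('g::{group_add, topological_space}, 'e::euclidean_space) chart set
   \<Rightarrow> 'g \<Rightarrow> 'g tvec \<Rightarrow> 'g tvec" where
  "left_push A a v = (\<lambda>f. if smooth_fun A f then v (f \<circ> (+) a) else 0)"

definition left_invariant ::
  "('g::{group_add, topological_space}, 'e::euclidean_space) chart set \<Rightarrow> 'g vfield \<Rightarrow> bool" where
  "left_invariant A X \<longleftrightarrow> vector_field A X \<and> (\<forall>a p. X (a + p) = left_push A a (X p))"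

definition left_invariant_basis3 ::
  "('g::{group_add, topological_space}, 'e::euclidean_space) chart set
   \<Rightarrow> 'g vfield \<Rightarrow> 'g vfield \<Rightarrow> 'g vfield \<Rightarrow> bool" where
  "left_invariant_basis3 A e1 e2 e3 \<longleftrightarrow>
     left_invariant A e1 \<and> left_invariant A e2 \<and> left_invariant A e3 \<and>
     (\<forall>X. left_invariant A X \<longrightarrow>
        (\<exists>!(a, b, c). X = a *\<^sub>V e1 + b *\<^sub>V e2 + c *\<^sub>V e3))"

type_synonym 'g metric_field = "'g \<Rightarrow> 'g tvec \<Rightarrow> 'g tvec \<Rightarrow> real"
type_synonym 'g endo_field = "'g \<Rightarrow> 'g tvec \<Rightarrow> 'g tvec"

definition on_fields :: "'g metric_field \<Rightarrow> 'g vfield \<Rightarrow> 'g vfield \<Rightarrow> 'g \<Rightarrow> real" where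
  "on_fields g X Y = (\<lambda>p. g p (X p) (Y p))"

definition endo_on :: "'g endo_field \<Rightarrow> 'g vfield \<Rightarrow> 'g vfield" where
  "endo_on J X = (\<lambda>p. J p (X p))"

text \<open>Index one: some timelike \<open>v\<close> has a positive definite orthogonal complement.\<close>

definition lorentzian_metric ::
  "('g::topological_space, 'e::euclidean_space) chart set \<Rightarrow> 'g metric_field \<Rightarrow> bool" where
  "lorentzian_metric A g \<longleftrightarrow>
     (\<forall>p. \<forall>u\<in>tangent_space A p. \<forall>v\<in>tangent_space A p.
        g p u v = g p v u \<and>
        (\<forall>c. g p (c *\<^sub>T u) v = c * g p u v) \<and>
        (\<forall>w\<in>tangent_space A p. g p (u + v) w = g p u w + g p v w)) \<and>
     (\<forall>p. \<exists>v\<in>tangent_space A p. g p v v < 0 \<and>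
        (\<forall>u\<in>tangent_space A p. g p u v = 0 \<longrightarrow> u \<noteq> 0 \<longrightarrow> g p u u > 0)) \<and>
     (\<forall>X Y. vector_field A X \<longrightarrow> vector_field A Y \<longrightarrow> smooth_fun A (on_fields g X Y))"

definition left_invariant_metric ::
  "('g::{group_add, topological_space}, 'e::euclidean_space) chart set
   \<Rightarrow> 'g metric_field \<Rightarrow> bool" where
  "left_invariant_metric A g \<longleftrightarrow>
     (\<forall>a p. \<forall>u\<in>tangent_space A p. \<forall>v\<in>tangent_space A p.
        g (a + p) (left_push A a u) (left_push A a v) = g p u v)"

definition tensor11 ::
  "('g::topological_space, 'e::euclidean_space) chart set \<Rightarrow> 'g endo_field \<Rightarrow> bool" where
  "tensor11 A J \<longleftrightarrow>
     (\<forall>p. \<forall>u\<in>tangent_space A p. J p u \<in> tangent_space A p \<and>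
        (\<forall>c. J p (c *\<^sub>T u) = c *\<^sub>T J p u) \<and>
        (\<forall>v\<in>tangent_space A p. J p (u + v) = J p u + J p v)) \<and>
     (\<forall>X. vector_field A X \<longrightarrow> vector_field A (endo_on J X))"

definition product_structure ::
  "('g::topological_space, 'e::euclidean_space) chart set \<Rightarrow> 'g endo_field \<Rightarrow> bool" where
  "product_structure A J \<longleftrightarrow>
     tensor11 A J \<and> (\<forall>p. \<forall>u\<in>tangent_space A p. J p (J p u) = u)"

definition left_invariant_tensor11 ::
  "('g::{group_add, topological_space}, 'e::euclidean_space) chart set
   \<Rightarrow> 'g endo_field \<Rightarrow> bool" where
  "left_invariant_tensor11 A J \<longleftrightarrow>
     (\<forall>a p. \<forall>u\<in>tangent_space A p. J (a + p) (left_push A a u) = left_push A a (J p u))"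

definition pseudo_orthonormal3 ::
  "'g metric_field \<Rightarrow> 'g vfield \<Rightarrow> 'g vfield \<Rightarrow> 'g vfield \<Rightarrow> bool" where
  "pseudo_orthonormal3 g e1 e2 e3 \<longleftrightarrow>
     (\<forall>p. on_fields g e1 e1 p = 1 \<and> on_fields g e2 e2 p = 1 \<and> on_fields g e3 e3 p = -1 \<and>
          on_fields g e1 e2 p = 0 \<and> on_fields g e1 e3 p = 0 \<and> on_fields g e2 e3 p = 0 \<and>
          on_fields g e2 e1 p = 0 \<and> on_fields g e3 e1 p = 0 \<and> on_fields g e3 e2 p = 0)"

type_synonym 'g connection = "'g vfield \<Rightarrow> 'g vfield \<Rightarrow> 'g vfield"

definition affine_connection ::
  "('g::topological_space, 'e::euclidean_space) chart set \<Rightarrow> 'g connection \<Rightarrow> bool" where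
  "affine_connection A D \<longleftrightarrow>
     (\<forall>X Y. vector_field A X \<longrightarrow> vector_field A Y \<longrightarrow>
        vector_field A (D X Y) \<and>
        (\<forall>Z. vector_field A Z \<longrightarrow>
           D (X + Y) Z = D X Z + D Y Z \<and> D X (Y + Z) = D X Y + D X Z) \<and>
        (\<forall>h. smooth_fun A h \<longrightarrow>
           D (h *\<^sub>F X) Y = h *\<^sub>F D X Y \<and>
           D X (h *\<^sub>F Y) = (\<lambda>p. X p h) *\<^sub>F Y + h *\<^sub>F D X Y))"

definition levi_civita ::
  "('g::topological_space, 'e::euclidean_space) chart set
   \<Rightarrow> 'g metric_field \<Rightarrow> 'g connection \<Rightarrow> bool" where
  "levi_civita A g D \<longleftrightarrow> affine_connection A D \<and>
     (\<forall>X Y. vector_field A X \<longrightarrow> vector_field A Y \<longrightarrow> D X Y - D Y X = bracket X Y) \<and>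
     (\<forall>X Y Z. vector_field A X \<longrightarrow> vector_field A Y \<longrightarrow> vector_field A Z \<longrightarrow>
        (\<forall>p. X p (on_fields g Y Z) = on_fields g (D X Y) Z p + on_fields g Y (D X Z) p))"

definition nabla_endo :: "'g connection \<Rightarrow> 'g endo_field \<Rightarrow> 'g vfield \<Rightarrow> 'g vfield \<Rightarrow> 'g vfield" where
  "nabla_endo D J X Y = D X (endo_on J Y) - endo_on J (D X Y)"

definition canonical_connection :: "'g connection \<Rightarrow> 'g endo_field \<Rightarrow> 'g connection" where
  "canonical_connection D J X Y = D X Y - (1/2) *\<^sub>V nabla_endo D J X (endo_on J Y)"

definition kobayashi_nomizu :: "'g connection \<Rightarrow> 'g endo_field \<Rightarrow> 'g connection" where
  "kobayashi_nomizu D J X Y = canonical_connection D J X Y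
     - (1/4) *\<^sub>V (nabla_endo D J Y (endo_on J X) - nabla_endo D J (endo_on J Y) X)"

definition curvature :: "'g connection \<Rightarrow> 'g vfield \<Rightarrow> 'g vfield \<Rightarrow> 'g vfield \<Rightarrow> 'g vfield" where
  "curvature D X Y Z = D X (D Y Z) - D Y (D X Z) - D (bracket X Y) Z"

definition ricci3 ::
  "'g metric_field \<Rightarrow> 'g connection \<Rightarrow> 'g vfield \<Rightarrow> 'g vfield \<Rightarrow> 'g vfield
   \<Rightarrow> 'g vfield \<Rightarrow> 'g vfield \<Rightarrow> 'g \<Rightarrow> real" where
  "ricci3 g D e1 e2 e3 X Y p =
     - on_fields g (curvature D X e1 Y) e1 p
     - on_fields g (curvature D X e2 Y) e2 p
     + on_fields g (curvature D X e3 Y) e3 p"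

definition symmetrization ::
  "('g vfield \<Rightarrow> 'g vfield \<Rightarrow> 'g \<Rightarrow> real) \<Rightarrow> 'g vfield \<Rightarrow> 'g vfield \<Rightarrow> 'g \<Rightarrow> real" where
  "symmetrization T X Y p = (T X Y p + T Y X p) / 2"

definition lie_derivative ::
  "'g vfield \<Rightarrow> ('g vfield \<Rightarrow> 'g vfield \<Rightarrow> 'g \<Rightarrow> real) \<Rightarrow> 'g vfield \<Rightarrow> 'g vfield \<Rightarrow> 'g \<Rightarrow> real" where
  "lie_derivative \<xi> T X Y p = \<xi> p (T X Y) - T (bracket \<xi> X) Y p - T X (bracket \<xi> Y) p"

text \<open>Below, \<open>D\<close> is the Levi-Civita connection, from which the Kobayashi-Nomizu one is formed.\<close>

definition left_invariant_ricci_collineation ::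
  "('g::{group_add, topological_space}, 'e::euclidean_space) chart set \<Rightarrow> 'g metric_field
   \<Rightarrow> 'g endo_field \<Rightarrow> 'g connection \<Rightarrow> 'g vfield \<Rightarrow> 'g vfield \<Rightarrow> 'g vfield \<Rightarrow> 'g vfield \<Rightarrow> bool" where
  "left_invariant_ricci_collineation A g J D e1 e2 e3 \<xi> \<longleftrightarrow>
     left_invariant A \<xi> \<and>
     (\<forall>X Y. vector_field A X \<longrightarrow> vector_field A Y \<longrightarrow>
        (\<forall>p. lie_derivative \<xi> (symmetrization (ricci3 g (kobayashi_nomizu D J) e1 e2 e3)) X Y p = 0))"

definition admits_left_invariant_ricci_collineations ::
  "('g::{group_add, topological_space}, 'e::euclidean_space) chart set \<Rightarrow> 'g metric_field
   \<Rightarrow> 'g endo_field \<Rightarrow> 'g connection \<Rightarrow> 'g vfield \<Rightarrow> 'g vfield \<Rightarrow> 'g vfield \<Rightarrow> bool" where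
  "admits_left_invariant_ricci_collineations A g J D e1 e2 e3 \<longleftrightarrow>
     (\<exists>\<xi>. \<xi> \<noteq> 0 \<and> left_invariant_ricci_collineation A g J D e1 e2 e3 \<xi>)"

end

theory Submission
  imports Defs
begin

text \<open>
  Write \<open>K\<close> for the Kobayashi-Nomizu connection.  It preserves the two eigenbundles of \<open>J\<close>: if \<open>Y\<close>
  lies in one of them and \<open>P\<close> is the projection onto it, then \<open>K X Y\<close> is \<open>P (D X Y)\<close> for \<open>X\<close> in the
  same eigenbundle and \<open>P (bracket X Y)\<close> for \<open>X\<close> in the other one.  As \<open>e1\<close>, \<open>e2\<close> span an abelian
  ideal, \<open>e1\<close>, \<open>e2\<close>, \<open>e3\<close> are parallel for \<open>K\<close> in the directions \<open>e1\<close> and \<open>e2\<close>, and \<open>K e3\<close>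
  maps the frame to constant combinations of \<open>e1\<close>, \<open>e2\<close>, so \<open>K\<close> is flat.  Hence its Ricci tensor
  vanishes and every left-invariant field is a collineation; \<open>e1\<close> is a nonzero one.
\<close>

subsection \<open>Smooth functions and tangent spaces\<close>

text \<open>\<open>Ck_on\<close> takes derivatives in the full space. On an open set, agreement on
  \<open>S\<close> is agreement near each of its points, so it passes to the derivatives, and
  induction iterates this.\<close>

lemma Ck_on_cong:
  assumes "open S" "Ck_on k f S" "\<And>x. x \<in> S \<Longrightarrow> f x = g x"
  shows "Ck_on k g S"
  using assms(2,3)
proof (induction k arbitrary: f g)
  case 0
  then show ?case using continuous_on_cong[of S S f g] by simp
next
  case (Suc k)
  have diff: "f differentiable (at x)" if "x \<in> S" for x
    using Suc.prems(1) that by simp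
  have "g differentiable (at x)" if "x \<in> S" for x
  proof -
    obtain f' where "(f has_derivative f') (at x)"
      using diff[OF \<open>x \<in> S\<close>] unfolding differentiable_def by blast
    then have "(g has_derivative f') (at x)"
      by (rule has_derivative_transform_within_open[OF _ assms(1) \<open>x \<in> S\<close> Suc.prems(2)])
    then show ?thesis by (rule differentiableI)
  qed
  moreover have "Ck_on k (\<lambda>x. frechet_derivative g (at x) v) S" for v
  proof (rule Suc.IH)
    show "Ck_on k (\<lambda>x. frechet_derivative f (at x) v) S" using Suc.prems(1) by simp
    fix x assume x: "x \<in> S"
    show "frechet_derivative f (at x) v = frechet_derivative g (at x) v"
      using frechet_derivative_transform_within_open[OF diff[OF x] assms(1) x Suc.prems(2)]
      by simp
  qed
  ultimately show ?case by simp
qed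

lemma Ck_on_Suc_imp: "Ck_on (Suc k) f S \<Longrightarrow> Ck_on k f S"
proof (induction k arbitrary: f)
  case 0
  then show ?case
    by (auto intro!: continuous_at_imp_continuous_on differentiable_imp_continuous_within)
next
  case (Suc k)
  then show ?case unfolding Ck_on.simps(2)[of "Suc k"] Ck_on.simps(2)[of k] by blast
qed

lemma Ck_on_const: "Ck_on k (\<lambda>x. c) S"
  by (induction k arbitrary: c) auto

lemma Ck_on_add:
  assumes "open S" "Ck_on k f S" "Ck_on k g S"
  shows "Ck_on k (\<lambda>x. f x + g x) S"
  using assms(2,3)
proof (induction k arbitrary: f g)
  case 0
  then show ?case by (auto intro: continuous_on_add)
next
  case (Suc k)
  have "Ck_on k (\<lambda>x. frechet_derivative (\<lambda>x. f x + g x) (at x) v) S" for v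
  \<comment> \<open>The sum rule gives the derivative only at points of \<open>S\<close>, hence the
    passage through \<open>Ck_on_cong\<close>.\<close>
  proof (rule Ck_on_cong[OF assms(1)])
    show "Ck_on k (\<lambda>x. frechet_derivative f (at x) v + frechet_derivative g (at x) v) S"
      using Suc.prems by (intro Suc.IH) simp_all
    fix x assume "x \<in> S"
    then have "f differentiable (at x)" "g differentiable (at x)" using Suc.prems by simp_all
    then have "((\<lambda>x. f x + g x) has_derivative
        (\<lambda>v. frechet_derivative f (at x) v + frechet_derivative g (at x) v)) (at x)"
      by (intro has_derivative_add) (simp_all add: frechet_derivative_works[symmetric])
    from frechet_derivative_at[OF this]
    show "frechet_derivative f (at x) v + frechet_derivative g (at x) v
        = frechet_derivative (\<lambda>x. f x + g x) (at x) v" by metis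
  qed
  then show ?case using Suc.prems by simp
qed

lemma Ck_on_mult:
  fixes f g :: "'e::euclidean_space \<Rightarrow> real"
  assumes "open S" "Ck_on k f S" "Ck_on k g S"
  shows "Ck_on k (\<lambda>x. f x * g x) S"
  using assms(2,3)
proof (induction k arbitrary: f g)
  case 0
  then show ?case by (auto intro: continuous_on_mult)
next
  case (Suc k)
  have "Ck_on k (\<lambda>x. frechet_derivative (\<lambda>x. f x * g x) (at x) v) S" for v
  proof (rule Ck_on_cong[OF assms(1)])
    \<comment> \<open>The product rule leaves undifferentiated factors, so \<open>f\<close> and
      \<open>g\<close> themselves are lowered from order \<open>Suc k\<close> to order
      \<open>k\<close>.\<close>
    show "Ck_on k (\<lambda>x. f x * frechet_derivative g (at x) v + frechet_derivative f (at x) v * g x) S"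
      using Suc.prems Ck_on_Suc_imp[OF Suc.prems(1)] Ck_on_Suc_imp[OF Suc.prems(2)]
      by (intro Ck_on_add[OF assms(1)] Suc.IH) simp_all
    fix x assume "x \<in> S"
    then have "f differentiable (at x)" "g differentiable (at x)" using Suc.prems by simp_all
    then have "((\<lambda>x. f x * g x) has_derivative
        (\<lambda>v. f x * frechet_derivative g (at x) v + frechet_derivative f (at x) v * g x)) (at x)"
      by (intro has_derivative_mult) (simp_all add: frechet_derivative_works[symmetric])
    from frechet_derivative_at[OF this]
    show "f x * frechet_derivative g (at x) v + frechet_derivative f (at x) v * g x
        = frechet_derivative (\<lambda>x. f x * g x) (at x) v" by metis
  qed
  then show ?case using Suc.prems by simp
qed

lemma smooth_on_imp_differentiable: "smooth_on f S \<Longrightarrow> x \<in> S \<Longrightarrow> f differentiable (at x)"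
  unfolding smooth_on_def by (drule spec[of _ "Suc 0"]) simp

text \<open>The operators of \<open>tangent_space\<close> with the chart held fixed, so that a
  tangent vector becomes a linear function of \<open>w\<close>.\<close>

definition chart_vec ::
  "('g::topological_space, 'e::euclidean_space) chart set \<Rightarrow> 'g \<Rightarrow> ('g, 'e) chart \<Rightarrow> 'e \<Rightarrow> 'g tvec" where
  "chart_vec A p c w = (\<lambda>f. if smooth_fun A f
     then frechet_derivative (f \<circ> inv_into (fst c) (snd c)) (at (snd c p)) w else 0)"

section \<open>Charts and tangent spaces of a smooth atlas\<close>

context
  fixes A :: "('g::{t2_space, second_countable_topology}, 'e::euclidean_space) chart set"
  assumes A: "smooth_atlas A"
begin

lemma chart_open: "(U, \<phi>) \<in> A \<Longrightarrow> open (\<phi> ` U)"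
  and chart_dom_open: "(U, \<phi>) \<in> A \<Longrightarrow> open U"
  and chart_homeo: "(U, \<phi>) \<in> A \<Longrightarrow> homeomorphism U (\<phi> ` U) \<phi> (inv_into U \<phi>)"
  and chart_transition: "(U, \<phi>) \<in> A \<Longrightarrow> (V, \<psi>) \<in> A \<Longrightarrow>
        smooth_on (\<psi> \<circ> inv_into U \<phi>) (\<phi> ` (U \<inter> V))"
proof -
  show "open (\<phi> ` U)" "open U" "homeomorphism U (\<phi> ` U) \<phi> (inv_into U \<phi>)"
    if "(U, \<phi>) \<in> A"
    using bspec[OF A[unfolded smooth_atlas_def, THEN conjunct2, THEN conjunct1] that] by simp_all
  show "smooth_on (\<psi> \<circ> inv_into U \<phi>) (\<phi> ` (U \<inter> V))"
    if "(U, \<phi>) \<in> A" "(V, \<psi>) \<in> A"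
    using bspec[OF A[unfolded smooth_atlas_def, THEN conjunct2, THEN conjunct2] that(1)] that(2)
    by auto
qed

lemma chart_inv: "(U, \<phi>) \<in> A \<Longrightarrow> q \<in> U \<Longrightarrow> inv_into U \<phi> (\<phi> q) = q"
  using homeomorphism_apply1[OF chart_homeo] .

lemma chart_around: obtains U \<phi> where "(U, \<phi>) \<in> A" "p \<in> U"
proof -
  have "p \<in> (\<Union>(U, \<phi>)\<in>A. U)" using A[unfolded smooth_atlas_def, THEN conjunct1] by simp
  then show ?thesis using that by auto
qed

lemma chart_open_Int: "(U, \<phi>) \<in> A \<Longrightarrow> (V, \<psi>) \<in> A \<Longrightarrow> open (\<phi> ` (U \<inter> V))"
  using homeomorphism_imp_open_map[OF chart_homeo, of U \<phi> "U \<inter> V"]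
  by (auto simp: openin_open_eq chart_dom_open chart_open open_Int)

lemma smooth_fun_differentiable:
  assumes "smooth_fun A f" "(U, \<phi>) \<in> A" "p \<in> U"
  shows "(f \<circ> inv_into U \<phi>) differentiable (at (\<phi> p))"
  using assms by (intro smooth_on_imp_differentiable[of _ "\<phi> ` U"]) (auto simp: smooth_fun_def)

lemma smooth_fun_const: "smooth_fun A (\<lambda>p. c)"
  by (auto simp: smooth_fun_def smooth_on_def Ck_on_const comp_def)

lemma smooth_fun_add: "smooth_fun A f \<Longrightarrow> smooth_fun A h \<Longrightarrow> smooth_fun A (\<lambda>p. f p + h p)"
  unfolding smooth_fun_def smooth_on_def comp_def split_beta
  by (intro ballI allI Ck_on_add chart_open) (simp_all del: Ck_on.simps)

lemma smooth_fun_mult: "smooth_fun A f \<Longrightarrow> smooth_fun A h \<Longrightarrow> smooth_fun A (\<lambda>p. f p * h p)"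
  unfolding smooth_fun_def smooth_on_def comp_def split_beta
  by (intro ballI allI Ck_on_mult chart_open) (simp_all del: Ck_on.simps)

lemma chart_vec_add:
  assumes "(U, \<phi>) \<in> A" "p \<in> U"
  shows "chart_vec A p (U, \<phi>) (v + w) = chart_vec A p (U, \<phi>) v + chart_vec A p (U, \<phi>) w"
proof
  show "chart_vec A p (U, \<phi>) (v + w) f = (chart_vec A p (U, \<phi>) v + chart_vec A p (U, \<phi>) w) f" for f
    using linear_add[OF linear_frechet_derivative[OF smooth_fun_differentiable[OF _ assms, of f]],
        of v w]
    by (simp add: chart_vec_def)
qed

lemma chart_vec_scale:
  assumes "(U, \<phi>) \<in> A" "p \<in> U"
  shows "chart_vec A p (U, \<phi>) (c *\<^sub>R w) = c *\<^sub>T chart_vec A p (U, \<phi>) w"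
proof
  show "chart_vec A p (U, \<phi>) (c *\<^sub>R w) f = (c *\<^sub>T chart_vec A p (U, \<phi>) w) f" for f
    using linear_cmul[OF linear_frechet_derivative[OF smooth_fun_differentiable[OF _ assms, of f]],
        of c w]
    by (simp add: chart_vec_def tscale_def)
qed

text \<open>This is the chain rule through the transition map, whose derivative carries
  \<open>w\<close> to the new chart.\<close>

lemma chart_vec_change:
  assumes U: "(U, \<phi>) \<in> A" "p \<in> U" and V: "(V, \<psi>) \<in> A" "p \<in> V"
  shows "chart_vec A p (U, \<phi>) w =
    chart_vec A p (V, \<psi>) (frechet_derivative (\<psi> \<circ> inv_into U \<phi>) (at (\<phi> p)) w)"
proof -
  have "frechet_derivative (f \<circ> inv_into U \<phi>) (at (\<phi> p)) w =
      frechet_derivative (f \<circ> inv_into V \<psi>) (at (\<psi> p))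
        (frechet_derivative (\<psi> \<circ> inv_into U \<phi>) (at (\<phi> p)) w)"
    if f: "smooth_fun A f" for f
  proof -
    let ?S = "\<phi> ` (U \<inter> V)" and ?t = "\<psi> \<circ> inv_into U \<phi>" and ?h = "f \<circ> inv_into V \<psi>"
    have p: "\<phi> p \<in> ?S" using U V by blast
    have tp: "?t (\<phi> p) = \<psi> p" using chart_inv[OF U] by simp
    have "frechet_derivative (f \<circ> inv_into U \<phi>) (at (\<phi> p)) = frechet_derivative (?h \<circ> ?t) (at (\<phi> p))"
      \<comment> \<open>The two expressions of \<open>f\<close> agree only on the overlap
        \<open>?S\<close>, which is an open neighbourhood of \<open>\<phi> p\<close>.\<close>
      by (rule frechet_derivative_transform_within_open
          [OF smooth_fun_differentiable[OF f U] chart_open_Int[OF U(1) V(1)] p])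
        (use chart_inv[OF U(1)] chart_inv[OF V(1)] in auto)
    also have "\<dots> = frechet_derivative ?h (at (?t (\<phi> p))) \<circ> frechet_derivative ?t (at (\<phi> p))"
      using smooth_on_imp_differentiable[OF chart_transition[OF U(1) V(1)] p]
        smooth_fun_differentiable[OF f V]
      by (intro frechet_derivative_compose) (simp_all only: tp)
    finally show ?thesis by (simp add: chart_inv[OF U])
  qed
  then show ?thesis by (simp add: chart_vec_def fun_eq_iff)
qed

text \<open>The definition lets the chart vary with the vector; \<open>chart_vec_change\<close>
  moves every vector into one chart, so the tangent space is a linear image of the model
  space.\<close>

lemma tangent_space_chart:
  assumes "(U, \<phi>) \<in> A" "p \<in> U"
  shows "tangent_space A p = range (chart_vec A p (U, \<phi>))"
proof
  show "tangent_space A p \<subseteq> range (chart_vec A p (U, \<phi>))"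
  proof
    fix v assume "v \<in> tangent_space A p"
    then obtain V \<psi> w where V: "(V, \<psi>) \<in> A" "p \<in> V" "v = chart_vec A p (V, \<psi>) w"
      unfolding tangent_space_def chart_vec_def by force
    show "v \<in> range (chart_vec A p (U, \<phi>))"
      unfolding V(3) chart_vec_change[OF V(1,2) assms] by blast
  qed
  show "range (chart_vec A p (U, \<phi>)) \<subseteq> tangent_space A p"
    using assms unfolding tangent_space_def chart_vec_def by fastforce
qed

lemma tangent_add:
  assumes "u \<in> tangent_space A p" "v \<in> tangent_space A p"
  shows "u + v \<in> tangent_space A p"
proof -
  obtain U \<phi> where U: "(U, \<phi>) \<in> A" "p \<in> U" by (rule chart_around)
  show ?thesis
    using assms unfolding tangent_space_chart[OF U]
    by (auto simp only: chart_vec_add[OF U, symmetric] image_iff)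
qed

lemma tangent_scale:
  assumes "u \<in> tangent_space A p"
  shows "c *\<^sub>T u \<in> tangent_space A p"
proof -
  obtain U \<phi> where U: "(U, \<phi>) \<in> A" "p \<in> U" by (rule chart_around)
  show ?thesis
    using assms unfolding tangent_space_chart[OF U]
    by (auto simp only: chart_vec_scale[OF U, symmetric] image_iff)
qed

section \<open>Tangent vectors as derivations\<close>

lemma tangent_const: "v \<in> tangent_space A p \<Longrightarrow> v (\<lambda>q. c) = 0"
  by (auto simp: tangent_space_def comp_def)

lemma tangent_not_smooth: "v \<in> tangent_space A p \<Longrightarrow> \<not> smooth_fun A f \<Longrightarrow> v f = 0"
  by (auto simp: tangent_space_def)

text \<open>The Leibniz rule, computed in a chart; smoothness of \<open>f\<close>, \<open>h\<close>
  and their product selects the derivative branch of \<open>chart_vec\<close>.\<close>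

lemma tangent_mult:
  assumes v: "v \<in> tangent_space A p" and f: "smooth_fun A f" and h: "smooth_fun A h"
  shows "v (\<lambda>q. f q * h q) = f p * v h + v f * h p"
proof -
  obtain U \<phi> where U: "(U, \<phi>) \<in> A" "p \<in> U" using chart_around by metis
  obtain w where w: "v = chart_vec A p (U, \<phi>) w"
    using v unfolding tangent_space_chart[OF U] by blast
  let ?f = "f \<circ> inv_into U \<phi>" and ?h = "h \<circ> inv_into U \<phi>"
  have "(?f has_derivative frechet_derivative ?f (at (\<phi> p))) (at (\<phi> p))"
    "(?h has_derivative frechet_derivative ?h (at (\<phi> p))) (at (\<phi> p))"
    using smooth_fun_differentiable[OF f U] smooth_fun_differentiable[OF h U]
    unfolding frechet_derivative_works .
  from has_derivative_mult[OF this]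
  have "frechet_derivative (\<lambda>x. ?f x * ?h x) (at (\<phi> p))
      = (\<lambda>w. ?f (\<phi> p) * frechet_derivative ?h (at (\<phi> p)) w
         + frechet_derivative ?f (at (\<phi> p)) w * ?h (\<phi> p))"
    by (rule frechet_derivative_at[symmetric])
  moreover have "(\<lambda>q. f q * h q) \<circ> inv_into U \<phi> = (\<lambda>x. ?f x * ?h x)" by (simp add: comp_def)
  moreover have "?f (\<phi> p) = f p" "?h (\<phi> p) = h p" using chart_inv[OF U] by simp_all
  ultimately show ?thesis
    using smooth_fun_mult[OF f h] f h by (simp only: w chart_vec_def fst_conv snd_conv if_True)
qed

lemma tangent_plus:
  assumes v: "v \<in> tangent_space A p" and f: "smooth_fun A f" and h: "smooth_fun A h"
  shows "v (\<lambda>q. f q + h q) = v f + v h"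
proof -
  obtain U \<phi> where U: "(U, \<phi>) \<in> A" "p \<in> U" using chart_around by metis
  obtain w where w: "v = chart_vec A p (U, \<phi>) w"
    using v unfolding tangent_space_chart[OF U] by blast
  let ?f = "f \<circ> inv_into U \<phi>" and ?h = "h \<circ> inv_into U \<phi>"
  have "(?f has_derivative frechet_derivative ?f (at (\<phi> p))) (at (\<phi> p))"
    "(?h has_derivative frechet_derivative ?h (at (\<phi> p))) (at (\<phi> p))"
    using smooth_fun_differentiable[OF f U] smooth_fun_differentiable[OF h U]
    unfolding frechet_derivative_works .
  from has_derivative_add[OF this]
  have "frechet_derivative (\<lambda>x. ?f x + ?h x) (at (\<phi> p))
      = (\<lambda>w. frechet_derivative ?f (at (\<phi> p)) w + frechet_derivative ?h (at (\<phi> p)) w)"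
    by (rule frechet_derivative_at[symmetric])
  moreover have "(\<lambda>q. f q + h q) \<circ> inv_into U \<phi> = (\<lambda>x. ?f x + ?h x)" by (simp add: comp_def)
  ultimately show ?thesis
    using smooth_fun_add[OF f h] f h by (simp only: w chart_vec_def fst_conv snd_conv if_True)
qed

section \<open>Vector fields and brackets\<close>

lemma vector_field_add:
  assumes "vector_field A X" "vector_field A Y"
  shows "vector_field A (X + Y)"
  unfolding vector_field_def
proof (intro conjI allI impI)
  show "(X + Y) p \<in> tangent_space A p" for p
    using assms tangent_add unfolding vector_field_def plus_fun_def[of X Y] by blast
  show "smooth_fun A (\<lambda>p. (X + Y) p f)" if "smooth_fun A f" for f
    using assms that unfolding vector_field_def plus_fun_apply by (intro smooth_fun_add) blast+
qed

lemma vector_field_fscale: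
  assumes "smooth_fun A h" "vector_field A X"
  shows "vector_field A (h *\<^sub>F X)"
  unfolding vector_field_def
proof (intro conjI allI impI)
  show "(h *\<^sub>F X) p \<in> tangent_space A p" for p
    using assms tangent_scale unfolding vector_field_def fscale_def by blast
  show "smooth_fun A (\<lambda>p. (h *\<^sub>F X) p f)" if "smooth_fun A f" for f
    using assms that unfolding vector_field_def fscale_def tscale_def
    by (intro smooth_fun_mult) blast+
qed

lemma vector_field_minus:
  assumes "vector_field A X"
  shows "vector_field A (- X)"
proof -
  have "- X = (\<lambda>p. -1) *\<^sub>F X" by (simp add: fun_eq_iff fscale_def tscale_def)
  then show ?thesis using vector_field_fscale[OF smooth_fun_const assms] by metis
qed

lemma vector_field_diff:
  assumes "vector_field A X" "vector_field A Y"
  shows "vector_field A (X - Y)"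
  using vector_field_add[OF assms(1) vector_field_minus[OF assms(2)]] by simp

lemma vector_field_cscale:
  assumes "vector_field A X"
  shows "vector_field A (c *\<^sub>V X)"
proof -
  have "c *\<^sub>V X = (\<lambda>p. c) *\<^sub>F X" by (simp add: fun_eq_iff fscale_def cscale_def)
  then show ?thesis using vector_field_fscale[OF smooth_fun_const assms] by metis
qed

text \<open>The correction term arises when \<open>Z\<close> differentiates the factor
  \<open>h\<close> in the product of \<open>h\<close> with \<open>\<lambda>q. X q f\<close>.\<close>

lemma bracket_fscale_left:
  assumes X: "vector_field A X" and Z: "vector_field A Z" and h: "smooth_fun A h"
  shows "bracket (h *\<^sub>F X) Z = h *\<^sub>F bracket X Z - (\<lambda>p. Z p h) *\<^sub>F X"
proof (intro ext)
  fix p f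
  have Zp: "Z p \<in> tangent_space A p" using Z unfolding vector_field_def by blast
  have "Z p (\<lambda>q. h q * X q f) = h p * Z p (\<lambda>q. X q f) + Z p h * X p f"
  proof (cases "smooth_fun A f")
    case True
    then have "smooth_fun A (\<lambda>q. X q f)" using X unfolding vector_field_def by blast
    then show ?thesis by (rule tangent_mult[OF Zp h])
  next
    \<comment> \<open>On a non-smooth \<open>f\<close> every \<open>X q f\<close> has the default
      value 0, so both sides vanish.\<close>
    case False
    then have "X q f = 0" for q
      using X tangent_not_smooth[of "X q"] unfolding vector_field_def by blast
    then show ?thesis using tangent_const[OF Zp, of 0] by simp
  qed
  then show "bracket (h *\<^sub>F X) Z p f = (h *\<^sub>F bracket X Z - (\<lambda>p. Z p h) *\<^sub>F X) p f"
    by (simp add: bracket_def fscale_def tscale_def algebra_simps)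
qed

lemma bracket_add_left:
  assumes X: "vector_field A X" and Y: "vector_field A Y" and Z: "vector_field A Z"
  shows "bracket (X + Y) Z = bracket X Z + bracket Y Z"
proof (intro ext)
  fix p f
  have Zp: "Z p \<in> tangent_space A p" using Z unfolding vector_field_def by blast
  have "Z p (\<lambda>q. X q f + Y q f) = Z p (\<lambda>q. X q f) + Z p (\<lambda>q. Y q f)"
  proof (cases "smooth_fun A f")
    case True
    then have "smooth_fun A (\<lambda>q. X q f)" "smooth_fun A (\<lambda>q. Y q f)"
      using X Y unfolding vector_field_def by blast+
    then show ?thesis by (rule tangent_plus[OF Zp])
  next
    case False
    then have "X q f = 0" "Y q f = 0" for q
      using X Y tangent_not_smooth[of "X q"] tangent_not_smooth[of "Y q"]
      unfolding vector_field_def by blast+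
    then show ?thesis using tangent_const[OF Zp, of 0] by simp
  qed
  then show "bracket (X + Y) Z p f = (bracket X Z + bracket Y Z) p f"
    by (simp add: bracket_def algebra_simps)
qed

end

subsection \<open>Pseudo-orthonormal frames\<close>

locale frame3 =
  fixes A :: "('g::{t2_space, second_countable_topology}, 'e::euclidean_space) chart set"
    and g :: "'g metric_field" and e1 e2 e3 :: "'g vfield"
  assumes A: "smooth_atlas A" and dim3: "DIM('e) = 3"
    and metric: "lorentzian_metric A g"
    and frame: "vector_field A e1" "vector_field A e2" "vector_field A e3"
    and orthonormal: "pseudo_orthonormal3 g e1 e2 e3"
begin

lemma field_tangent: "vector_field A X \<Longrightarrow> X p \<in> tangent_space A p"
  unfolding vector_field_def by blast

lemma metric_props:
  assumes "u \<in> tangent_space A p" "v \<in> tangent_space A p"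
  shows metric_sym: "g p u v = g p v u"
    and metric_scale: "g p (c *\<^sub>T u) v = c * g p u v"
    and metric_add: "w \<in> tangent_space A p \<Longrightarrow> g p (u + w) v = g p u v + g p w v"
  using metric assms unfolding lorentzian_metric_def by blast+

lemma frame_products:
  "g p (e1 p) (e1 p) = 1" "g p (e2 p) (e2 p) = 1" "g p (e3 p) (e3 p) = -1"
  "g p (e1 p) (e2 p) = 0" "g p (e1 p) (e3 p) = 0" "g p (e2 p) (e3 p) = 0"
  "g p (e2 p) (e1 p) = 0" "g p (e3 p) (e1 p) = 0" "g p (e3 p) (e2 p) = 0"
  using orthonormal unfolding pseudo_orthonormal3_def on_fields_def by blast+

text \<open>Coefficients form a nested pair because \<open>real \<times> real \<times> real\<close>
  is a Euclidean space of dimension 3, which allows a dimension count against the model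
  space.\<close>

definition frame_comb :: "'g \<Rightarrow> real \<times> real \<times> real \<Rightarrow> 'g tvec" where
  "frame_comb p c = fst c *\<^sub>T e1 p + fst (snd c) *\<^sub>T e2 p + snd (snd c) *\<^sub>T e3 p"

lemma frame_comb_products:
  shows "g p (frame_comb p c) (e1 p) = fst c"
    and "g p (frame_comb p c) (e2 p) = fst (snd c)"
    and "g p (frame_comb p c) (e3 p) = - snd (snd c)"
    and frame_comb_tangent: "frame_comb p c \<in> tangent_space A p"
proof -
  note t = field_tangent[OF frame(1), of p] field_tangent[OF frame(2), of p]
    field_tangent[OF frame(3), of p]
  note ts = t[THEN tangent_scale[OF A]]
  note m = metric_add[OF tangent_add[OF A ts(1,2)] _ ts(3)] metric_add[OF ts(1) _ ts(2)]
     metric_scale[OF t(1)] metric_scale[OF t(2)] metric_scale[OF t(3)]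
  show "g p (frame_comb p c) (e1 p) = fst c" "g p (frame_comb p c) (e2 p) = fst (snd c)"
    "g p (frame_comb p c) (e3 p) = - snd (snd c)"
    unfolding frame_comb_def by (simp_all add: m t frame_products)
  show "frame_comb p c \<in> tangent_space A p"
    unfolding frame_comb_def by (intro tangent_add[OF A] ts)
qed

text \<open>Taking products with the frame is a linear map on the model space which is onto, hence
  one-to-one because the dimensions agree.\<close>

lemma tangent_expand:
  assumes v: "v \<in> tangent_space A p"
  shows "v = frame_comb p (g p v (e1 p), g p v (e2 p), - g p v (e3 p))"
proof -
  obtain U \<phi> where U: "(U, \<phi>) \<in> A" "p \<in> U" using chart_around[OF A] by metis
  let ?T = "chart_vec A p (U, \<phi>)"
  note T = tangent_space_chart[OF A U]
  have inT: "?T w \<in> tangent_space A p" for w unfolding T by simp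
  \<comment> \<open>The last coordinate is negated because \<open>e3\<close> has square -1; thus
    \<open>M\<close> reads off the coefficients of a frame combination.\<close>
  define M where "M w = (g p (?T w) (e1 p), g p (?T w) (e2 p), - g p (?T w) (e3 p))" for w
  note t = field_tangent[OF frame(1), of p] field_tangent[OF frame(2), of p]
    field_tangent[OF frame(3), of p]
  have "linear M"
    by (rule linearI)
      (simp_all add: M_def chart_vec_add[OF A U] chart_vec_scale[OF A U] metric_add inT t metric_scale)
  moreover have "surj M"
  proof
    show "range M \<subseteq> UNIV" by simp
    show "UNIV \<subseteq> range M"
    proof
      fix c :: "real \<times> real \<times> real"
      obtain w where "frame_comb p c = ?T w" using frame_comb_tangent[of p c] unfolding T by blast
      then have "M w = c" unfolding M_def by (metis frame_comb_products(1-3) minus_minus prod.collapse)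
      then show "c \<in> range M" by blast
    qed
  qed
  ultimately have inj: "inj M"
    by (rule linear_surjective_imp_injective) (simp add: dim3)
  obtain w where w: "v = ?T w" using v unfolding T by blast
  \<comment> \<open>The combination built from the products of \<open>v\<close> has the same
    products as \<open>v\<close>; injectivity of \<open>M\<close> then identifies the two model
    vectors.\<close>
  obtain w' where w': "frame_comb p (M w) = ?T w'" using frame_comb_tangent[of p "M w"] unfolding T by blast
  have "M w' = M w" unfolding M_def[of w'] w'[symmetric] by (simp add: frame_comb_products)
  then have "w' = w" using inj by (simp add: inj_eq)
  then show ?thesis using w w' by (simp add: M_def)
qed

lemma field_expand:
  assumes X: "vector_field A X"
  shows "X = on_fields g X e1 *\<^sub>F e1 + on_fields g X e2 *\<^sub>F e2 + (\<lambda>p. - on_fields g X e3 p) *\<^sub>F e3"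
proof
  fix p
  show "X p = (on_fields g X e1 *\<^sub>F e1 + on_fields g X e2 *\<^sub>F e2 + (\<lambda>p. - on_fields g X e3 p) *\<^sub>F e3) p"
    using tangent_expand[OF field_tangent[OF X, of p]]
    by (simp add: frame_comb_def on_fields_def fscale_def)
qed

text \<open>The coefficients in \<open>field_expand\<close> are smooth because the metric is smooth
  on vector fields. Tensorial statements thereby reduce to the frame.\<close>

lemma frame_induct [consumes 1, case_names add fscale frame]:
  assumes X: "vector_field A X"
    and add: "\<And>X Y. vector_field A X \<Longrightarrow> vector_field A Y \<Longrightarrow> P X \<Longrightarrow> P Y \<Longrightarrow> P (X + Y)"
    and scale: "\<And>h X. smooth_fun A h \<Longrightarrow> vector_field A X \<Longrightarrow> P X \<Longrightarrow> P (h *\<^sub>F X)"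
    and "P e1" "P e2" "P e3"
  shows "P X"
proof -
  have s: "smooth_fun A (on_fields g X e)" if "vector_field A e" for e
    using metric X that unfolding lorentzian_metric_def by blast
  have s3: "smooth_fun A (\<lambda>p. - on_fields g X e3 p)"
    using smooth_fun_mult[OF A smooth_fun_const[OF A, of "-1"] s[OF frame(3)]] by simp
  note f = vector_field_fscale[OF A s[OF frame(1)] frame(1)]
    vector_field_fscale[OF A s[OF frame(2)] frame(2)] vector_field_fscale[OF A s3 frame(3)]
  have "P (on_fields g X e1 *\<^sub>F e1 + on_fields g X e2 *\<^sub>F e2 + (\<lambda>p. - on_fields g X e3 p) *\<^sub>F e3)"
    by (intro add scale s s3 frame assms(4-6) f vector_field_add[OF A])
  then show ?thesis using field_expand[OF X] by simp
qed

end

subsection \<open>Affine connections and their curvature\<close>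

lemma affine_connectionD:
  assumes "affine_connection A D" "vector_field A X" "vector_field A Y"
  shows connection_field: "vector_field A (D X Y)"
    and connection_add_left: "vector_field A Z \<Longrightarrow> D (X + Y) Z = D X Z + D Y Z"
    and connection_add_right: "vector_field A Z \<Longrightarrow> D X (Y + Z) = D X Y + D X Z"
    and connection_fscale_left: "smooth_fun A h \<Longrightarrow> D (h *\<^sub>F X) Y = h *\<^sub>F D X Y"
    and connection_fscale_right:
      "smooth_fun A h \<Longrightarrow> D X (h *\<^sub>F Y) = (\<lambda>p. X p h) *\<^sub>F Y + h *\<^sub>F D X Y"
  using assms unfolding affine_connection_def by blast+

lemma smooth_deriv: "vector_field A X \<Longrightarrow> smooth_fun A h \<Longrightarrow> smooth_fun A (\<lambda>p. X p h)"
  unfolding vector_field_def by blast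

lemma cscale_eq_fscale: "c *\<^sub>V X = (\<lambda>p. c) *\<^sub>F X"
  by (simp add: cscale_def fscale_def)

text \<open>A constant is a smooth function, and its derivative term in the Leibniz rule
  vanishes.\<close>

lemma connection_cscale:
  assumes A: "smooth_atlas A" and "affine_connection A D" and X: "vector_field A X" "vector_field A Y"
  shows connection_cscale_left: "D (c *\<^sub>V X) Y = c *\<^sub>V D X Y"
    and connection_cscale_right: "D X (c *\<^sub>V Y) = c *\<^sub>V D X Y"
proof -
  show "D (c *\<^sub>V X) Y = c *\<^sub>V D X Y"
    using connection_fscale_left[OF assms(2-4) smooth_fun_const[OF A]] by (simp add: cscale_eq_fscale)
  have "X p (\<lambda>q. c) = 0" for p using X(1) tangent_const[OF A] unfolding vector_field_def by blast
  then show "D X (c *\<^sub>V Y) = c *\<^sub>V D X Y"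
    using connection_fscale_right[OF assms(2-4) smooth_fun_const[OF A, of c]]
    by (simp add: cscale_eq_fscale fscale_def tscale_def fun_eq_iff)
qed

context
  fixes A :: "('g::{t2_space, second_countable_topology}, 'e::euclidean_space) chart set"
    and D :: "'g connection"
  assumes A: "smooth_atlas A" and D: "affine_connection A D"
    and bracket: "\<And>X Y. vector_field A X \<Longrightarrow> vector_field A Y \<Longrightarrow> vector_field A (bracket X Y)"
begin

lemmas field_intros = vector_field_add[OF A] vector_field_diff[OF A] vector_field_minus[OF A]
  vector_field_fscale[OF A] connection_field[OF D] smooth_deriv bracket

lemma connection_minus:
  assumes "vector_field A X" "vector_field A Y"
  shows connection_minus_left: "D (- X) Y = - D X Y" and connection_minus_right: "D X (- Y) = - D X Y"
proof -
  have m: "- Z = (-1) *\<^sub>V Z" for Z :: "'g vfield" by (simp add: cscale_def tscale_def fun_eq_iff)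
  show "D (- X) Y = - D X Y" "D X (- Y) = - D X Y"
    unfolding m using connection_cscale[OF A D assms] by blast+
qed

lemma connection_diff_left:
  assumes "vector_field A X" "vector_field A Y" "vector_field A Z"
  shows "D (X - Y) Z = D X Z - D Y Z"
  using connection_add_left[OF D assms(1) vector_field_minus[OF A assms(2)] assms(3)]
    connection_minus_left[OF assms(2,3)]
  by simp

text \<open>Tensoriality is shown in the first and third arguments, since \<open>ricci3\<close>
  always puts a frame field in the second.\<close>

lemma curvature_add_left:
  assumes [simp]: "vector_field A X" "vector_field A X'" "vector_field A Y" "vector_field A Z"
  shows "curvature D (X + X') Y Z = curvature D X Y Z + curvature D X' Y Z"
  by (simp add: curvature_def bracket_add_left[OF A] connection_add_left[OF D]
      connection_add_right[OF D] field_intros)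

lemma curvature_add_right:
  assumes [simp]: "vector_field A X" "vector_field A Y" "vector_field A Z" "vector_field A Z'"
  shows "curvature D X Y (Z + Z') = curvature D X Y Z + curvature D X Y Z'"
  by (simp add: curvature_def connection_add_right[OF D] field_intros)

text \<open>The term with \<open>Y p h\<close> from differentiating \<open>h *\<^sub>F D X Z\<close>
  along \<open>Y\<close> cancels the one from \<open>bracket_fscale_left\<close>.\<close>

lemma curvature_fscale_left:
  assumes [simp]: "vector_field A X" "vector_field A Y" "vector_field A Z" "smooth_fun A h"
  shows "curvature D (h *\<^sub>F X) Y Z = h *\<^sub>F curvature D X Y Z"
proof (intro ext)
  show "curvature D (h *\<^sub>F X) Y Z p f = (h *\<^sub>F curvature D X Y Z) p f" for p f
    by (simp add: curvature_def bracket_fscale_left[OF A] connection_diff_left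
        connection_fscale_left[OF D] connection_fscale_right[OF D] field_intros
        fscale_def[of _ "_ - _ - _"])
      (simp add: fscale_def tscale_def algebra_simps)
qed

text \<open>First-order terms in \<open>h\<close> cancel by symmetry in \<open>X\<close> and
  \<open>Y\<close>; the commutator of second derivatives of \<open>h\<close> cancels the derivative
  of \<open>h\<close> along the bracket.\<close>

lemma curvature_fscale_right:
  assumes [simp]: "vector_field A X" "vector_field A Y" "vector_field A Z" "smooth_fun A h"
  shows "curvature D X Y (h *\<^sub>F Z) = h *\<^sub>F curvature D X Y Z"
proof (intro ext)
  show "curvature D X Y (h *\<^sub>F Z) p f = (h *\<^sub>F curvature D X Y Z) p f" for p f
    by (simp add: curvature_def connection_add_right[OF D]
        connection_fscale_right[OF D] field_intros)
      (simp add: fscale_def tscale_def bracket_def algebra_simps)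
qed

end

subsection \<open>The Kobayashi-Nomizu connection of a product structure\<close>

context
  fixes A :: "('g::{t2_space, second_countable_topology}, 'e::euclidean_space) chart set"
    and J :: "'g endo_field"
  assumes A: "smooth_atlas A" and J: "product_structure A J"
begin

lemma field_J: "vector_field A X \<Longrightarrow> vector_field A (endo_on J X)"
  using J unfolding product_structure_def tensor11_def by blast

lemma J_props:
  assumes X: "vector_field A X"
  shows J_J: "endo_on J (endo_on J X) = X"
    and J_fscale: "endo_on J (h *\<^sub>F X) = h *\<^sub>F endo_on J X"
    and J_add: "vector_field A Y \<Longrightarrow> endo_on J (X + Y) = endo_on J X + endo_on J Y"
proof -
  have t: "Z p \<in> tangent_space A p" if "vector_field A Z" for Z p
    using that unfolding vector_field_def by blast
  show "endo_on J (endo_on J X) = X"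
    using J t[OF X] unfolding product_structure_def endo_on_def by blast
  show "endo_on J (h *\<^sub>F X) = h *\<^sub>F endo_on J X"
    using J t[OF X] unfolding product_structure_def tensor11_def endo_on_def fscale_def by blast
  show "endo_on J (X + Y) = endo_on J X + endo_on J Y" if Y: "vector_field A Y"
    using J t[OF X] t[OF Y]
    unfolding product_structure_def tensor11_def endo_on_def plus_fun_def[of X Y]
      plus_fun_def[of "\<lambda>p. J p (X p)"]
    by blast
qed

lemma J_minus: "vector_field A X \<Longrightarrow> endo_on J (- X) = - endo_on J X"
  using J_fscale[of X "\<lambda>p. -1"] by (simp add: fscale_def tscale_def fun_eq_iff fun_Compl_def)

lemma J_diff:
  "vector_field A X \<Longrightarrow> vector_field A Y \<Longrightarrow> endo_on J (X - Y) = endo_on J X - endo_on J Y"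
  using J_add[OF _ vector_field_minus[OF A], of X Y] J_minus by simp

lemma J_cscale: "vector_field A X \<Longrightarrow> endo_on J (c *\<^sub>V X) = c *\<^sub>V endo_on J X"
  by (simp add: cscale_eq_fscale J_fscale)

text \<open>Since \<open>J\<close> is an involution, the covariant derivatives of \<open>J\<close>
  unfold to terms in \<open>D\<close> and \<open>J\<close> alone, to which additivity and the
  Leibniz rule apply directly.\<close>

lemma kobayashi_nomizu_eq:
  assumes "vector_field A X" "vector_field A Y"
  shows "kobayashi_nomizu D J X Y = D X Y
    - (1/2) *\<^sub>V (D X Y - endo_on J (D X (endo_on J Y)))
    - (1/4) *\<^sub>V (D Y X - endo_on J (D Y (endo_on J X))
        - (D (endo_on J Y) (endo_on J X) - endo_on J (D (endo_on J Y) X)))"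
  using assms by (simp add: kobayashi_nomizu_def canonical_connection_def nabla_endo_def J_J)

text \<open>The derivative terms of the arguments cancel because \<open>J\<close> is an involution.\<close>

lemma affine_connection_kobayashi_nomizu:
  assumes D: "affine_connection A D"
  shows "affine_connection A (kobayashi_nomizu D J)"
proof -
  note field = vector_field_add[OF A] vector_field_diff[OF A] vector_field_minus[OF A]
    vector_field_fscale[OF A] vector_field_cscale[OF A] connection_field[OF D] field_J
    smooth_deriv
  note rules = J_add J_diff J_fscale J_J connection_add_left[OF D] connection_add_right[OF D]
    connection_fscale_left[OF D] connection_fscale_right[OF D] kobayashi_nomizu_eq
  show ?thesis
    unfolding affine_connection_def
  proof (intro allI impI conjI ext)
    fix X Y Z :: "'g vfield" and h p f
    assume [simp]: "vector_field A X" "vector_field A Y"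
    show "vector_field A (kobayashi_nomizu D J X Y)"
      by (simp add: rules field)
    show "kobayashi_nomizu D J (X + Y) Z p f = (kobayashi_nomizu D J X Z + kobayashi_nomizu D J Y Z) p f"
      "kobayashi_nomizu D J X (Y + Z) p f = (kobayashi_nomizu D J X Y + kobayashi_nomizu D J X Z) p f"
      if [simp]: "vector_field A Z"
      by (simp_all add: rules field) (simp_all add: cscale_def tscale_def algebra_simps)
    show "kobayashi_nomizu D J (h *\<^sub>F X) Y p f = (h *\<^sub>F kobayashi_nomizu D J X Y) p f"
      "kobayashi_nomizu D J X (h *\<^sub>F Y) p f
        = ((\<lambda>p. X p h) *\<^sub>F Y + h *\<^sub>F kobayashi_nomizu D J X Y) p f"
      if [simp]: "smooth_fun A h"
      by (simp_all add: rules field) (simp_all add: fscale_def cscale_def tscale_def field_simps)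
  qed
qed

end

subsection \<open>Flatness for the given Lie algebra\<close>

locale nonunimodular_frame = frame3 A g e1 e2 e3
  for A :: "('g::{t2_space, second_countable_topology}, 'e::euclidean_space) chart set"
    and g :: "'g metric_field" and e1 e2 e3 :: "'g vfield" +
  fixes J :: "'g endo_field" and D :: "'g connection" and \<alpha> \<beta> \<gamma> \<delta> :: real
  assumes bracket12: "bracket e1 e2 = 0"
    and bracket13: "bracket e1 e3 = \<alpha> *\<^sub>V e1 + \<beta> *\<^sub>V e2"
    and bracket23: "bracket e2 e3 = \<gamma> *\<^sub>V e1 + \<delta> *\<^sub>V e2"
    and J: "product_structure A J"
    and J1: "endo_on J e1 = e1" and J2: "endo_on J e2 = e2" and J3: "endo_on J e3 = - e3"
    and LC: "levi_civita A g D"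
begin

abbreviation K :: "'g connection" where "K \<equiv> kobayashi_nomizu D J"

section \<open>Covariant derivatives of the frame fields\<close>

lemma affine: "affine_connection A D"
  and torsion_free: "vector_field A X \<Longrightarrow> vector_field A Y \<Longrightarrow> D X Y - D Y X = bracket X Y"
  and compatible: "vector_field A X \<Longrightarrow> vector_field A Y \<Longrightarrow> vector_field A Z \<Longrightarrow>
    X p (on_fields g Y Z) = on_fields g (D X Y) Z p + on_fields g Y (D X Z) p"
  using LC unfolding levi_civita_def by blast+

text \<open>Torsion-freeness turns the bracket into a difference of covariant derivatives, which are
  vector fields. This discharges the bracket assumption of the curvature lemmas.\<close>

lemma bracket_field:
  assumes "vector_field A X" "vector_field A Y"
  shows "vector_field A (bracket X Y)"
  unfolding torsion_free[OF assms, symmetric]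
  by (intro vector_field_diff[OF A] connection_field[OF affine] assms)

lemma affine_K: "affine_connection A K"
  by (rule affine_connection_kobayashi_nomizu[OF A J affine])

text \<open>Products of frame fields are constant, so the left side of metric compatibility is
  zero.\<close>

lemma D_frame_skew:
  assumes "vector_field A X" "Y \<in> {e1, e2, e3}" "Z \<in> {e1, e2, e3}"
  shows "on_fields g (D X Y) Z p = - on_fields g (D X Z) Y p"
proof -
  have f: "vector_field A Y" "vector_field A Z" using assms frame by auto
  have "\<exists>c. on_fields g Y Z = (\<lambda>q. c)"
    using assms(2,3) by (auto simp: on_fields_def frame_products)
  then obtain c where "on_fields g Y Z = (\<lambda>q. c)" ..
  then have "X p (on_fields g Y Z) = 0"
    using tangent_const[OF A field_tangent[OF assms(1)]] by simp
  moreover have "on_fields g Y (D X Z) p = on_fields g (D X Z) Y p"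
    unfolding on_fields_def
    by (intro metric_sym field_tangent f connection_field[OF affine] assms)
  ultimately show ?thesis using compatible[OF assms(1) f] by simp
qed

lemma D_sym_12: "D e1 e2 = D e2 e1"
  using torsion_free[OF frame(1,2)] bracket12 by simp

text \<open>The Koszul formula on the abelian ideal spanned by \<open>e1\<close> and \<open>e2\<close>.\<close>

lemma D_12:
  assumes "X \<in> {e1, e2}" "Y \<in> {e1, e2}"
  shows "on_fields g (D X Y) e1 p = 0" "on_fields g (D X Y) e2 p = 0"
  \<comment> \<open>Skewness with equal arguments removes the diagonal products;
    \<open>D_sym_12\<close> carries this to \<open>D e1 e2\<close> against \<open>e1\<close> and
    \<open>D e2 e1\<close> against \<open>e2\<close>; skewness in \<open>e1\<close>,
    \<open>e2\<close> gives the remaining ones.\<close>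
  using assms D_frame_skew[OF frame(1), of e1 e1 p] D_frame_skew[OF frame(1), of e1 e2 p]
    D_frame_skew[OF frame(1), of e2 e2 p]
    D_frame_skew[OF frame(2), of e1 e1 p] D_frame_skew[OF frame(2), of e1 e2 p]
    D_frame_skew[OF frame(2), of e2 e2 p] D_sym_12
  by auto

text \<open>By \<open>D_12\<close>, \<open>D X Y\<close> is a multiple of \<open>e3\<close>, so
  \<open>J\<close> negates it and \<open>D X Y + J (D X Y)\<close> vanishes; the terms with factor
  \<open>1/4\<close> cancel since \<open>J\<close> fixes \<open>X\<close> and
  \<open>Y\<close>.\<close>

lemma K_12:
  assumes "X \<in> {e1, e2}" "Y \<in> {e1, e2}"
  shows "K X Y = 0"
proof -
  have f: "vector_field A X" "vector_field A Y" and JX: "endo_on J X = X" "endo_on J Y = Y"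
    using assms frame J1 J2 by auto
  let ?c = "\<lambda>p. - on_fields g (D X Y) e3 p"
  have W: "D X Y = ?c *\<^sub>F e3"
  proof (intro ext)
    show "D X Y p f = (?c *\<^sub>F e3) p f" for p f
      using fun_cong[OF fun_cong[OF field_expand[OF connection_field[OF affine f]]], of p f]
      by (simp add: D_12[OF assms] fscale_def tscale_def)
  qed
  have "endo_on J (D X Y) = - D X Y"
    \<comment> \<open>The coefficient \<open>?c\<close> contains \<open>D X Y\<close> itself, so
      \<open>W\<close> is substituted at chosen places; as a rewrite rule it would loop.\<close>
    by (subst (1 2) W)
      (simp only: J_fscale[OF A J frame(3)] J3, simp add: fscale_def tscale_def fun_eq_iff)
  then show ?thesis
    by (simp add: kobayashi_nomizu_eq[OF A J f] JX cscale_def tscale_def fun_eq_iff)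
qed

text \<open>Dual to the previous case: \<open>D e3 e3\<close> is orthogonal to \<open>e3\<close>,
  hence fixed by \<open>J\<close>, while \<open>J\<close> negates \<open>e3\<close>.\<close>

lemma K_33: "K e3 e3 = 0"
proof -
  have "on_fields g (D e3 e3) e3 p = 0" for p using D_frame_skew[OF frame(3), of e3 e3 p] by simp
  then have W: "D e3 e3 = on_fields g (D e3 e3) e1 *\<^sub>F e1 + on_fields g (D e3 e3) e2 *\<^sub>F e2"
    (is "_ = ?W")
  proof (intro ext)
    show "D e3 e3 p f = ?W p f" for p f
      using fun_cong[OF fun_cong[OF field_expand[OF connection_field[OF affine frame(3,3)]]], of p f]
        \<open>on_fields g (D e3 e3) e3 p = 0\<close>
      by (simp add: fscale_def tscale_def)
  qed
  have "smooth_fun A (on_fields g (D e3 e3) e)" if "vector_field A e" for e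
    using metric connection_field[OF affine frame(3,3)] that unfolding lorentzian_metric_def by blast
  then have JW: "endo_on J (D e3 e3) = D e3 e3"
    by (subst (1 2) W)
      (simp add: J_add[OF A J] J_fscale[OF A J] J1 J2 vector_field_fscale[OF A] frame)
  note f = vector_field_minus[OF A frame(3)] connection_field[OF affine frame(3,3)]
  show ?thesis
    by (simp add: kobayashi_nomizu_eq[OF A J frame(3,3)] J3 connection_minus_left[OF A affine]
        connection_minus_right[OF A affine] J_minus[OF A J] JW f frame bracket_field)
      (simp add: cscale_def tscale_def fun_eq_iff)
qed

text \<open>The two values are the parts of \<open>bracket X e3\<close> and
  \<open>bracket e3 X\<close> in the -1 and +1 eigenbundles of \<open>J\<close>. The ideal spanned
  by \<open>e1\<close>, \<open>e2\<close> lies in the latter.\<close>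

lemma K_mixed:
  assumes "X \<in> {e1, e2}"
  shows "K X e3 = 0" "K e3 X = - bracket X e3"
proof -
  have f: "vector_field A X" and JX: "endo_on J X = X"
    using assms frame J1 J2 by auto
  have JB: "endo_on J (bracket X e3) = bracket X e3"
    using assms by (auto simp: bracket13 bracket23 J_add[OF A J] J_cscale[OF A J] J1 J2
        vector_field_cscale[OF A] frame)
  \<comment> \<open>Both covariant derivatives are expressed through the single unknown
    \<open>U\<close>, which cancels and leaves only the bracket \<open>B\<close>.\<close>
  define U where "U = D e3 X"
  define B where "B = bracket X e3"
  have fU: "vector_field A U" "vector_field A (endo_on J U)"
    unfolding U_def by (intro field_J[OF A J] connection_field[OF affine] frame f)+
  have fB: "vector_field A B" unfolding B_def by (rule bracket_field[OF f frame(3)])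
  have D: "D X e3 = B + U" using torsion_free[OF f frame(3)] by (simp add: U_def B_def algebra_simps)
  note r = kobayashi_nomizu_eq[OF A J f frame(3)] kobayashi_nomizu_eq[OF A J frame(3) f] JX J3
    connection_minus_left[OF A affine] connection_minus_right[OF A affine] J_minus[OF A J]
    J_add[OF A J] J_diff[OF A J]
    D U_def[symmetric] B_def[symmetric] JB[folded B_def] f frame fU fB bracket_field
    vector_field_minus[OF A]
  show "K X e3 = 0" "K e3 X = - bracket X e3"
    by (simp_all add: r vector_field_add[OF A])
      (simp_all add: cscale_def tscale_def fun_eq_iff field_simps)
qed

section \<open>Vanishing of the curvature\<close>

lemma K_null:
  assumes X: "vector_field A X"
  shows "K X 0 = 0" "K 0 X = 0"
  using connection_cscale[OF A affine_K X X, of 0] by (simp_all add: cscale_def tscale_def zero_fun_def)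

lemma bracket_frame:
  "bracket X X = 0" "bracket e2 e1 = 0" "bracket e3 e1 = - bracket e1 e3"
  "bracket e3 e2 = - bracket e2 e3"
proof -
  have swap: "bracket X Y = - bracket Y X" for X Y :: "'g vfield"
    by (simp add: bracket_def fun_eq_iff)
  show "bracket X X = 0" by (simp add: bracket_def fun_eq_iff)
  show "bracket e2 e1 = 0" "bracket e3 e1 = - bracket e1 e3" "bracket e3 e2 = - bracket e2 e3"
    using swap[of e2 e1] swap[of e3 e1] swap[of e3 e2] bracket12 by simp_all
qed

text \<open>The coefficients are constant, so the values on the frame suffice. Direction
  \<open>e3\<close> is excluded in the first claim because \<open>K e3\<close> sends
  \<open>e1\<close>, \<open>e2\<close> to brackets that may be nonzero.\<close>

lemma K_ideal:
  assumes "X \<in> {e1, e2, e3}" and B: "B = a *\<^sub>V e1 + b *\<^sub>V e2"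
  shows "X \<noteq> e3 \<Longrightarrow> K X B = 0" "K B X = 0"
proof -
  have X: "vector_field A X" using assms(1) frame by auto
  note f = frame(1,2)[THEN vector_field_cscale[OF A]]
  have z: "c *\<^sub>V (0 :: 'g vfield) = 0" for c by (simp add: cscale_def tscale_def fun_eq_iff)
  have K: "K e1 e1 = 0" "K e1 e2 = 0" "K e2 e1 = 0" "K e2 e2 = 0" "K e1 e3 = 0" "K e2 e3 = 0"
    using K_12 K_mixed(1) by blast+
  show "K B X = 0"
    unfolding B connection_add_left[OF affine_K f X]
      connection_cscale_left[OF A affine_K frame(1) X] connection_cscale_left[OF A affine_K frame(2) X]
    using assms(1) by (auto simp only: K z add_0)
  show "K X B = 0" if "X \<noteq> e3"
    unfolding B connection_add_right[OF affine_K X f]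
      connection_cscale_right[OF A affine_K X frame(1)] connection_cscale_right[OF A affine_K X frame(2)]
    using assms(1) that by (auto simp only: K z add_0)
qed

text \<open>\<open>K e1\<close> and \<open>K e2\<close> kill the frame and everything in the image
  of \<open>K e3\<close> on it; brackets of frame fields lie in the ideal and differentiate the
  frame to 0. For two equal directions the terms cancel.\<close>

lemma curvature_frame:
  assumes "X \<in> {e1, e2, e3}" "Y \<in> {e1, e2, e3}" "Z \<in> {e1, e2, e3}"
  shows "curvature K X Y Z = 0"
proof -
  let ?B = "bracket e1 e3" and ?C = "bracket e2 e3"
  have K: "K e1 e1 = 0" "K e1 e2 = 0" "K e2 e1 = 0" "K e2 e2 = 0" "K e1 e3 = 0" "K e2 e3 = 0"
    "K e3 e1 = - ?B" "K e3 e2 = - ?C" "K e3 e3 = 0"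
    using K_12 K_mixed K_33 by blast+
  have B: "vector_field A ?B" "vector_field A ?C"
    by (intro bracket_field frame)+
  \<comment> \<open>The squares 1 and -1 tell spacelike from timelike frame fields.\<close>
  have ne: "e1 \<noteq> e3" "e2 \<noteq> e3"
    using frame_products(1,2,3)[of undefined] by auto
  have KB: "K ?B W = 0" "K ?C W = 0" if "W \<in> {e1, e2, e3}" for W
    using K_ideal(2)[OF that bracket13] K_ideal(2)[OF that bracket23] by blast+
  have BK: "K e1 ?B = 0" "K e1 ?C = 0" "K e2 ?B = 0" "K e2 ?C = 0"
    using K_ideal(1)[OF _ bracket13] K_ideal(1)[OF _ bracket23] ne by blast+
  \<comment> \<open>Negated brackets occur as the values \<open>K e3 e1\<close>,
    \<open>K e3 e2\<close> and as the reversed brackets \<open>bracket e3 e1\<close>,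
    \<open>bracket e3 e2\<close>.\<close>
  have m: "K e1 (- ?B) = 0" "K e1 (- ?C) = 0" "K e2 (- ?B) = 0" "K e2 (- ?C) = 0"
    using connection_minus_right[OF A affine_K bracket_field frame(1) B(1)]
      connection_minus_right[OF A affine_K bracket_field frame(1) B(2)]
      connection_minus_right[OF A affine_K bracket_field frame(2) B(1)]
      connection_minus_right[OF A affine_K bracket_field frame(2) B(2)]
    by (simp_all only: BK minus_zero)
  have m': "K (- ?B) W = 0" "K (- ?C) W = 0" if W: "W \<in> {e1, e2, e3}" for W
  proof -
    have "vector_field A W" using W frame by auto
    then show "K (- ?B) W = 0" "K (- ?C) W = 0"
      using connection_minus_left[OF A affine_K bracket_field B(1)]
        connection_minus_left[OF A affine_K bracket_field B(2)]
      by (simp_all only: KB[OF W] minus_zero)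
  qed
  have Z: "vector_field A Z" using assms(3) frame by auto
  have KZ: "K e1 Z = 0" "K e2 Z = 0" using assms(3) K by auto
  have KKZ: "K e1 (K e3 Z) = 0" "K e2 (K e3 Z) = 0"
    using assms(3) m K_null[OF frame(1)] K_null[OF frame(2)] by (auto simp only: K)
  note simps = KZ KKZ K_null(1)[OF frame(1)] K_null(1)[OF frame(2)] K_null(1)[OF frame(3)]
    K_null(2)[OF Z] bracket12 bracket_frame KB[OF assms(3)] m'[OF assms(3)] diff_self diff_0_right
  show ?thesis
    using assms(1,2) unfolding curvature_def by (auto simp only: simps)
qed

lemma curvature_K_zero:
  assumes X: "vector_field A X" and Y: "Y \<in> {e1, e2, e3}" and Z: "vector_field A Z"
  shows "curvature K X Y Z = 0"
proof -
  have fY: "vector_field A Y" using Y frame by auto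
  \<comment> \<open>The first induction frees \<open>X\<close> while the third argument stays in the
    frame; the second frees \<open>Z\<close> for this arbitrary \<open>X\<close>.\<close>
  have X0: "curvature K X Y Z' = 0" if Z': "Z' \<in> {e1, e2, e3}" for Z'
    using X
  proof (induction X rule: frame_induct)
    case (add X X')
    have "vector_field A Z'" using Z' frame by auto
    then show ?case
      by (simp only: curvature_add_left[OF A affine_K bracket_field add(1,2) fY] add(3,4) add_0)
  next
    case (fscale h X)
    have "vector_field A Z'" using Z' frame by auto
    then show ?case
      using curvature_fscale_left[OF A affine_K bracket_field fscale(2) fY _ fscale(1)] fscale(3)
      by (simp add: fscale_def tscale_def fun_eq_iff)
  qed (use curvature_frame Y Z' in auto)
  show ?thesis
    using Z
  proof (induction Z rule: frame_induct)
    case (add Z Z')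
    then show ?case
      by (simp only: curvature_add_right[OF A affine_K bracket_field X fY] add_0)
  next
    case (fscale h Z)
    then show ?case
      using curvature_fscale_right[OF A affine_K bracket_field X fY]
      by (simp add: fscale_def tscale_def fun_eq_iff)
  qed (use X0 in auto)
qed

section \<open>Ricci tensor and collineations\<close>

lemma ricci_zero:
  assumes X: "vector_field A X" and Y: "vector_field A Y"
  shows "ricci3 g K e1 e2 e3 X Y p = 0"
proof -
  \<comment> \<open>Bilinearity is available on tangent vectors, so the zero vector is written as 0
    times \<open>Z p\<close>.\<close>
  have "g p 0 (Z p) = 0" if "vector_field A Z" for Z
    using metric_scale[OF field_tangent[OF that] field_tangent[OF that], where c = 0]
    by (simp add: tscale_def zero_fun_def)
  then show ?thesis
    by (simp add: ricci3_def on_fields_def curvature_K_zero[OF X _ Y] frame)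
qed

text \<open>The symmetrized tensor vanishes on vector fields. By \<open>bracket_field\<close> this
  covers the two bracket terms, and the first term differentiates a zero function.\<close>

lemma lie_derivative_ricci_zero:
  assumes "vector_field A \<xi>" "vector_field A X" "vector_field A Y"
  shows "lie_derivative \<xi> (symmetrization (ricci3 g K e1 e2 e3)) X Y p = 0"
proof -
  have "symmetrization (ricci3 g K e1 e2 e3) V W = (\<lambda>q. 0)"
    if "vector_field A V" "vector_field A W" for V W
    using that by (simp add: symmetrization_def ricci_zero fun_eq_iff)
  then show ?thesis
    using assms tangent_const[OF A field_tangent[OF assms(1)], where c = 0]
    by (simp add: lie_derivative_def bracket_field)
qed

text \<open>A zero field would have square 0 instead of 1; \<open>undefined\<close> serves as an
  arbitrary point of the group.\<close>

lemma e1_nonzero: "e1 \<noteq> 0"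
proof
  assume "e1 = 0"
  then have "e1 undefined = 0 *\<^sub>T e1 undefined" by (simp add: tscale_def zero_fun_def)
  then have "g undefined (e1 undefined) (e1 undefined) = 0 * g undefined (e1 undefined) (e1 undefined)"
    using metric_scale[OF field_tangent[OF frame(1)] field_tangent[OF frame(1)],
        where c = 0 and p = undefined]
    by (simp only:)
  then show False by (simp add: frame_products)
qed

end

theorem theorem4p6:
  fixes \<alpha> \<beta> \<gamma> \<delta> :: real
    and A :: "('g::{group_add, t2_space, second_countable_topology}, real ^ 3) chart set"
    and g :: "'g metric_field"
    and J :: "'g endo_field"
    and D :: "'g connection"
    and e1 e2 e3 :: "'g vfield"
  assumes "\<alpha> + \<delta> \<noteq> 0"
    and "\<alpha> * \<gamma> + \<beta> * \<delta> = 0"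
    and "lie_group A"
    and "connected (UNIV :: 'g set)"
    and "lorentzian_metric A g"
    and "left_invariant_metric A g"
    and "left_invariant_basis3 A e1 e2 e3"
    and "pseudo_orthonormal3 g e1 e2 e3"
    and "bracket e1 e2 = 0"
    and "bracket e1 e3 = \<alpha> *\<^sub>V e1 + \<beta> *\<^sub>V e2"
    and "bracket e2 e3 = \<gamma> *\<^sub>V e1 + \<delta> *\<^sub>V e2"
    and "product_structure A J"
    and "left_invariant_tensor11 A J"
    and "endo_on J e1 = e1"
    and "endo_on J e2 = e2"
    and "endo_on J e3 = - e3"
    and "levi_civita A g D"
  shows "admits_left_invariant_ricci_collineations A g J D e1 e2 e3"
proof -
  have inv: "left_invariant A e1" "left_invariant A e2" "left_invariant A e3"
    using assms(7) unfolding left_invariant_basis3_def by blast+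
  \<comment> \<open>Left invariance supplies the vector fields of the frame, and
    \<open>real ^ 3\<close> supplies the dimension.\<close>
  interpret nonunimodular_frame A g e1 e2 e3 J D \<alpha> \<beta> \<gamma> \<delta>
    by unfold_locales
      (use assms inv in \<open>simp_all add: lie_group_def left_invariant_def\<close>)
  show ?thesis
    unfolding admits_left_invariant_ricci_collineations_def left_invariant_ricci_collineation_def
    using e1_nonzero inv(1) lie_derivative_ricci_zero[OF frame(1)] by blast
qed

end
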